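(* Let $\xi>0$, $v_{\max}>0$, $\bar v>0$, $a_{\min}>0$, $\gamma>0$, let $\kappa_{\rm sf}\ge \kappa>0$, let $D_{\rm st}>D_{\rm sf}$ be real numbers, and let $\Phi$ be a finite set of integers $k>1$. Let $A\ge 0$, $B_1\ge 0$ and $B_k\ge 0$ for all $k\in\Phi$. Consider the connected automated vehicle dynamics with first-order lag $$\dot D_0 = v_1-v_0,\qquad \dot v_0=a_0,\qquad \dot a_0=\frac1\xi\,(u_0-a_0),\qquad \dot v_1=a_1,$$ with state $x=(D_0,v_0,a_0,v_1)$ and with the connected cruise controller $$u_0 = A\big(V(D_0)-v_0\big)+B_1\big(W(v_1)-v_0\big)+\sum_{k\in\Phi}B_k\big(W(v_k)-v_0\big),$$ where $V(D)=\min\{\kappa(D-D_{\rm st}),v_{\max}\}$ and $W(v)=\min\{v,v_{\max}\}$. Let $$h(x)=\kappa_{\rm sf}(D_0-D_{\rm sf})-v_0,\qquad h_{\rm e}(x)=\kappa_{\rm sf}(v_1-v_0)-a_0+\gamma\big(\kappa_{\rm sf}(D_0-D_{\rm sf})-v_0\big),$$ $$\mathcal S=\{x\in\mathbb R^4: h(x)\ge 0\},\qquad \mathcal S_{\rm e}=\{x\in\mathbb R^4: h_{\rm e}(x)\ge 0\}.$$ Suppose that $v_0\ge 0$, $|v_1-v_0|\le\bar v$, $|v_k-v_0|\le \bar v$ for all $k\in\Phi$, and $a_1\ge -a_{\min}$ (at all times along the motion), and that $$A\le \frac{(1-\xi\kappa_{\rm sf})^2}{4\xi}-\xi\Big(\gamma-\frac{1-\xi\kappa_{\rm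 sf}}{2\xi}\Big)^2,$$ $$A\ge \frac{\big(|\kappa_{\rm sf}-\xi\kappa_{\rm sf}^2-B_1|+\sum_{k\in\Phi}B_k\big)\bar v+\xi\kappa_{\rm sf}a_{\min}}{\kappa(D_{\rm st}-D_{\rm sf})}.$$ Then the closed-loop system is safe with respect to $\mathcal S\cap\mathcal S_{\rm e}$.
   Context: Here $D_0$ is the distance between the controlled vehicle (index $0$) and the vehicle immediately ahead (index $1$); $v_0,a_0$ are the speed and acceleration of the controlled vehicle; $v_1$ is the speed of the vehicle immediately ahead and $a_1=\dot v_1$ its acceleration; $v_k$, $k\in\Phi$, is the speed of the connected vehicle $k$ vehicles ahead. The signals $a_1(t)$ and $v_k(t)$, $k\in\Phi$, are exogenous (given) continuous functions of time. Safety: the closed-loop system is safe with respect to a set $\mathcal C\subset\mathbb R^4$ if every solution $x(t)$ (along which the stated bounds on $v_0$, $v_1-v_0$, $v_k-v_0$, $a_1$ hold) with $x(t_0)\in\mathcal C$ satisfies $x(t)\in\mathcal C$ for all $t\ge t_0$. *)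

theory Defs
  imports "HOL-Analysis.Analysis"
begin

text \<open>A state is \<open>x = (D\<^sub>0, v\<^sub>0, a\<^sub>0, v\<^sub>1)\<close>.\<close>

abbreviation D\<^sub>0 :: "real ^ 4 \<Rightarrow> real" where "D\<^sub>0 x \<equiv> x $ 1"
abbreviation v\<^sub>0 :: "real ^ 4 \<Rightarrow> real" where "v\<^sub>0 x \<equiv> x $ 2"
abbreviation a\<^sub>0 :: "real ^ 4 \<Rightarrow> real" where "a\<^sub>0 x \<equiv> x $ 3"
abbreviation v\<^sub>1 :: "real ^ 4 \<Rightarrow> real" where "v\<^sub>1 x \<equiv> x $ 4"

lemma vector_4 [simp]:
  "(vector [w, x, y, z] :: 'a::zero ^ 4) $ 1 = w"
  "(vector [w, x, y, z] :: 'a::zero ^ 4) $ 2 = x"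
  "(vector [w, x, y, z] :: 'a::zero ^ 4) $ 3 = y"
  "(vector [w, x, y, z] :: 'a::zero ^ 4) $ 4 = z"
  unfolding vector_def by simp_all

definition range_policy :: "real \<Rightarrow> real \<Rightarrow> real \<Rightarrow> real \<Rightarrow> real" where
  "range_policy \<kappa> D_st v_max D = min (\<kappa> * (D - D_st)) v_max"

definition speed_policy :: "real \<Rightarrow> real \<Rightarrow> real" where
  "speed_policy v_max v = min v v_max"

definition ccc_controller ::
  "real \<Rightarrow> real \<Rightarrow> (int \<Rightarrow> real) \<Rightarrow> int set \<Rightarrow> (real \<Rightarrow> real) \<Rightarrow> (real \<Rightarrow> real)
    \<Rightarrow> (int \<Rightarrow> real \<Rightarrow> real) \<Rightarrow> real \<Rightarrow> real ^ 4 \<Rightarrow> real" where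
  "ccc_controller A B\<^sub>1 B \<Phi> V W v t x =
     A * (V (D\<^sub>0 x) - v\<^sub>0 x) + B\<^sub>1 * (W (v\<^sub>1 x) - v\<^sub>0 x)
       + (\<Sum>k\<in>\<Phi>. B k * (W (v k t) - v\<^sub>0 x))"

definition lag_dynamics ::
  "real \<Rightarrow> (real \<Rightarrow> real) \<Rightarrow> (real \<Rightarrow> real ^ 4 \<Rightarrow> real) \<Rightarrow> real \<Rightarrow> real ^ 4 \<Rightarrow> real ^ 4" where
  "lag_dynamics \<xi> a\<^sub>1 u\<^sub>0 t x =
     vector [v\<^sub>1 x - v\<^sub>0 x, a\<^sub>0 x, (1 / \<xi>) * (u\<^sub>0 t x - a\<^sub>0 x), a\<^sub>1 t]"

text \<open>Solutions live on an arbitrary real interval \<open>J\<close>, so that solutions which are not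
  known to exist for all time are covered as well; at endpoints of \<open>J\<close> the derivative is
  one-sided.\<close>

definition solution_on :: "real set \<Rightarrow> (real \<Rightarrow> real ^ 4 \<Rightarrow> real ^ 4) \<Rightarrow> (real \<Rightarrow> real ^ 4) \<Rightarrow> bool" where
  "solution_on J f x \<longleftrightarrow>
     is_interval J \<and> (\<forall>t\<in>J. (x has_vector_derivative f t (x t)) (at t within J))"

text \<open>Only those motions count along which the time-dependent constraint \<open>P\<close> holds
  throughout.\<close>

definition safe_wrt ::
  "(real \<Rightarrow> real ^ 4 \<Rightarrow> real ^ 4) \<Rightarrow> (real \<Rightarrow> real ^ 4 \<Rightarrow> bool) \<Rightarrow> (real ^ 4) set \<Rightarrow> bool" where
  "safe_wrt f P C \<longleftrightarrow>
     (\<forall>J x t\<^sub>0. solution_on J f x \<longrightarrow> (\<forall>t\<in>J. P t (x t)) \<longrightarrow> t\<^sub>0 \<in> J \<longrightarrow> x t\<^sub>0 \<in> C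
        \<longrightarrow> (\<forall>t\<in>J. t\<^sub>0 \<le> t \<longrightarrow> x t \<in> C))"

definition motion_bounds ::
  "real \<Rightarrow> real \<Rightarrow> int set \<Rightarrow> (real \<Rightarrow> real) \<Rightarrow> (int \<Rightarrow> real \<Rightarrow> real) \<Rightarrow> real \<Rightarrow> real ^ 4 \<Rightarrow> bool" where
  "motion_bounds v_bar a_min \<Phi> a\<^sub>1 v t x \<longleftrightarrow>
     0 \<le> v\<^sub>0 x \<and> \<bar>v\<^sub>1 x - v\<^sub>0 x\<bar> \<le> v_bar \<and> (\<forall>k\<in>\<Phi>. \<bar>v k t - v\<^sub>0 x\<bar> \<le> v_bar) \<and> - a_min \<le> a\<^sub>1 t"

definition h :: "real \<Rightarrow> real \<Rightarrow> real ^ 4 \<Rightarrow> real" where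
  "h \<kappa>_sf D_sf x = \<kappa>_sf * (D\<^sub>0 x - D_sf) - v\<^sub>0 x"

definition h_e :: "real \<Rightarrow> real \<Rightarrow> real \<Rightarrow> real ^ 4 \<Rightarrow> real" where
  "h_e \<kappa>_sf D_sf \<gamma> x =
     \<kappa>_sf * (v\<^sub>1 x - v\<^sub>0 x) - a\<^sub>0 x + \<gamma> * (\<kappa>_sf * (D\<^sub>0 x - D_sf) - v\<^sub>0 x)"

definition S :: "real \<Rightarrow> real \<Rightarrow> (real ^ 4) set" where
  "S \<kappa>_sf D_sf = {x. 0 \<le> h \<kappa>_sf D_sf x}"

definition S_e :: "real \<Rightarrow> real \<Rightarrow> real \<Rightarrow> (real ^ 4) set" where
  "S_e \<kappa>_sf D_sf \<gamma> = {x. 0 \<le> h_e \<kappa>_sf D_sf \<gamma> x}"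

end

theory Submission
  imports Defs
begin

text \<open>
  Along a motion, \<open>h' = - \<gamma> h + h_e\<close>, and the two conditions on \<open>A\<close> give
  \<open>\<xi> h_e' \<ge> - (1 - \<xi> \<kappa>_sf - \<xi> \<gamma>) h_e + G min h 0\<close> with \<open>G = \<gamma> (1 - \<xi> \<kappa>_sf) - \<xi> \<gamma>\<^sup>2 \<ge> A\<close>,
  the right-hand side of the first condition. This system of
  differential inequalities is cooperative, so Gronwall's argument applied to
  \<open>(min h 0)\<^sup>2 + (min h_e 0)\<^sup>2\<close>, which is continuously differentiable, shows that both \<open>h\<close> and
  \<open>h_e\<close> remain nonnegative. Keeping the term \<open>min h 0\<close> makes the inequality valid outside
  the safe set as well, which avoids any argument about a first exit time.
\<close>

text \<open>Squaring removes the kink of the negative part: away from \<open>0\<close> the function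
  agrees locally with \<open>x\<^sup>2\<close> or with \<open>0\<close>, and at \<open>0\<close> its
  difference quotient is \<open>min y 0\<close>, which tends to \<open>0\<close>.\<close>

lemma has_real_derivative_min_zero_power2:
  "((\<lambda>x. (min x 0)\<^sup>2) has_real_derivative 2 * min x 0) (at (x::real))"
proof -
  consider "x < 0" | "x > 0" | "x = 0" by linarith
  then show ?thesis
  proof cases
    case 1
    have "((\<lambda>x. x\<^sup>2) has_real_derivative 2 * min x 0) (at x)"
      using 1 by (auto intro!: derivative_eq_intros)
    then show ?thesis
      by (rule has_field_derivative_transform_within_open[where S = "{..<0}"]) (use 1 in auto)
  next
    case 2
    have "((\<lambda>x. 0) has_real_derivative 2 * min x 0) (at x)"
      using 2 by (auto intro!: derivative_eq_intros)
    then show ?thesis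
      by (rule has_field_derivative_transform_within_open[where S = "{0<..}"]) (use 2 in auto)
  next
    case 3
    have "((\<lambda>y. min y 0) \<longlongrightarrow> min 0 (0::real)) (at 0)"
      by (intro tendsto_intros)
    then have "(\<lambda>y::real. min y 0) \<midarrow>0\<rightarrow> 0"
      by simp
    then have "((\<lambda>y. ((min y 0)\<^sup>2 - (min 0 0)\<^sup>2) / (y - 0)) \<longlongrightarrow> (0::real)) (at 0)"
      by (rule Lim_transform_eventually[where f = "\<lambda>y. min y 0"])
        (auto simp: eventually_at_filter min_def power2_eq_square)
    then show ?thesis
      using 3 by (simp add: has_field_derivative_iff)
  qed
qed

text \<open>The integrating factor \<open>exp (- L * t)\<close> turns the differential inequality
  into monotonicity: the product with \<open>f\<close> has derivative
  \<open>exp (- L * t) * (f' t - L * f t)\<close>, which is nonpositive.\<close>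

lemma gronwall_nonpos:
  fixes f f' :: "real \<Rightarrow> real"
  assumes "a \<le> b"
    and f: "\<And>t. t \<in> {a..b} \<Longrightarrow> (f has_real_derivative f' t) (at t within {a..b})"
    and le: "\<And>t. t \<in> {a..b} \<Longrightarrow> f' t \<le> L * f t"
    and "f a \<le> 0"
  shows "f b \<le> 0"
proof -
  let ?g = "\<lambda>t. exp (- L * t) * f t"
  have g: "(?g has_real_derivative exp (- L * t) * (f' t - L * f t)) (at t within {a..b})"
    if "t \<in> {a..b}" for t
    using f[OF that] by (auto intro!: derivative_eq_intros simp: algebra_simps)
  have "?g b \<le> ?g a"
  proof (rule DERIV_nonpos_imp_decreasing_open[OF \<open>a \<le> b\<close>])
    fix t assume t: "a < t" "t < b"
    then have "(?g has_real_derivative exp (- L * t) * (f' t - L * f t)) (at t)"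
      using g[of t] by (simp add: at_within_Icc_at)
    moreover have "exp (- L * t) * (f' t - L * f t) \<le> 0"
      using le[of t] t by (simp add: mult_nonneg_nonpos)
    ultimately show "\<exists>y. (?g has_real_derivative y) (at t) \<and> y \<le> 0"
      by blast
  next
    show "continuous_on {a..b} ?g"
      using g by (rule DERIV_continuous_on)
  qed
  also have "\<dots> \<le> 0"
    using \<open>f a \<le> 0\<close> by (simp add: mult_nonneg_nonpos)
  finally show ?thesis
    by (simp add: mult_le_0_iff)
qed

text \<open>The squared negative parts of \<open>p\<close> and \<open>q\<close> sum to an energy
  that starts at \<open>0\<close> and grows at most at a rate proportional to itself, so it stays
  \<open>0\<close>. Only the negative part of the other function enters each bound, so the coupling
  can be estimated by the energy.\<close>

lemma cooperative_nonneg: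
  fixes p q p' q' :: "real \<Rightarrow> real"
  assumes "a \<le> b" and "\<beta> \<ge> 0" and "\<delta> \<ge> 0"
    and p: "\<And>t. t \<in> {a..b} \<Longrightarrow> (p has_real_derivative p' t) (at t within {a..b})"
    and q: "\<And>t. t \<in> {a..b} \<Longrightarrow> (q has_real_derivative q' t) (at t within {a..b})"
    and p': "\<And>t. t \<in> {a..b} \<Longrightarrow> \<alpha> * p t + \<beta> * min (q t) 0 \<le> p' t"
    and q': "\<And>t. t \<in> {a..b} \<Longrightarrow> \<gamma> * q t + \<delta> * min (p t) 0 \<le> q' t"
    and "p a \<ge> 0" and "q a \<ge> 0"
  shows "p b \<ge> 0 \<and> q b \<ge> 0"
proof -
  let ?f = "\<lambda>t. (min (p t) 0)\<^sup>2 + (min (q t) 0)\<^sup>2"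
  let ?L = "2 * \<bar>\<alpha>\<bar> + 2 * \<bar>\<gamma>\<bar> + \<beta> + \<delta>"
  have "?f b \<le> 0"
  proof (rule gronwall_nonpos[OF \<open>a \<le> b\<close>, where L = ?L])
    fix t assume t: "t \<in> {a..b}"
    show "(?f has_real_derivative 2 * min (p t) 0 * p' t + 2 * min (q t) 0 * q' t)
        (at t within {a..b})"
      by (intro DERIV_add DERIV_chain2[OF has_real_derivative_min_zero_power2] p q t)
    define m n where "m = min (p t) 0" and "n = min (q t) 0"
    have mn: "m \<le> 0" "n \<le> 0" "m * p t = m\<^sup>2" "n * q t = n\<^sup>2"
      by (auto simp: m_def n_def min_def power2_eq_square)
    \<comment> \<open>Multiplying by the nonpositive \<open>m\<close> and \<open>n\<close> reverses
      the lower bounds on the derivatives into upper bounds on the growth of the energy.\<close>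
    have "m * p' t \<le> m * (\<alpha> * p t + \<beta> * n)" "n * q' t \<le> n * (\<gamma> * q t + \<delta> * m)"
      using p'[OF t] q'[OF t] mn by (auto simp: m_def n_def intro: mult_left_mono_neg)
    then have "2 * m * p' t + 2 * n * q' t
        \<le> 2 * (\<alpha> * (m * p t) + \<beta> * (m * n) + \<gamma> * (n * q t) + \<delta> * (m * n))"
      by (simp add: algebra_simps)
    also have "\<dots> = 2 * \<alpha> * m\<^sup>2 + 2 * \<gamma> * n\<^sup>2 + (\<beta> + \<delta>) * (2 * m * n)"
      by (simp add: mn algebra_simps)
    \<comment> \<open>Each square is at most \<open>m\<^sup>2 + n\<^sup>2\<close>, and so is the
      cross term \<open>2 * m * n\<close>; the coefficients add up to \<open>?L\<close>.\<close>
    also have "\<dots> \<le> 2 * \<bar>\<alpha>\<bar> * (m\<^sup>2 + n\<^sup>2) + 2 * \<bar>\<gamma>\<bar> * (m\<^sup>2 + n\<^sup>2) + (\<beta> + \<delta>) * (m\<^sup>2 + n\<^sup>2)"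
    proof (intro add_mono)
      show "2 * \<alpha> * m\<^sup>2 \<le> 2 * \<bar>\<alpha>\<bar> * (m\<^sup>2 + n\<^sup>2)" "2 * \<gamma> * n\<^sup>2 \<le> 2 * \<bar>\<gamma>\<bar> * (m\<^sup>2 + n\<^sup>2)"
        by (rule mult_mono; simp)+
      show "(\<beta> + \<delta>) * (2 * m * n) \<le> (\<beta> + \<delta>) * (m\<^sup>2 + n\<^sup>2)"
        using assms(2,3) by (intro mult_left_mono sum_squares_bound) auto
    qed
    finally show "2 * min (p t) 0 * p' t + 2 * min (q t) 0 * q' t \<le> ?L * ?f t"
      by (simp add: m_def n_def algebra_simps)
  qed (use assms in auto)
  then show ?thesis
    by (simp add: sum_power2_le_zero_iff min_def split: if_splits)
qed

text \<open>Measuring the gap from \<open>D_sf\<close> instead of \<open>D_st\<close> splits off the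
  constant \<open>\<kappa> * (D_st - D_sf)\<close>. Beyond \<open>D_sf\<close> the steeper slope
  \<open>\<kappa>_sf\<close> dominates the rest by \<open>h\<close> plus the speed; below
  \<open>D_sf\<close> the rest is nonpositive. Having \<open>max\<close> with \<open>0\<close> keeps
  the bound true where \<open>h\<close> is negative.\<close>

lemma range_policy_minus_speed_le:
  assumes "\<kappa>_sf \<ge> \<kappa>" and "\<kappa> > 0" and "v\<^sub>0 x \<ge> 0"
  shows "range_policy \<kappa> D_st v_max (D\<^sub>0 x) - v\<^sub>0 x \<le> max (h \<kappa>_sf D_sf x) 0 - \<kappa> * (D_st - D_sf)"
proof -
  have "\<kappa> * (D\<^sub>0 x - D_sf) \<le> max (h \<kappa>_sf D_sf x) 0 + v\<^sub>0 x"
  proof (cases "D\<^sub>0 x \<ge> D_sf")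
    case True
    then have "\<kappa> * (D\<^sub>0 x - D_sf) \<le> \<kappa>_sf * (D\<^sub>0 x - D_sf)"
      using assms by (intro mult_right_mono) auto
    then show ?thesis by (simp add: h_def)
  next
    case False
    then have "\<kappa> * (D\<^sub>0 x - D_sf) \<le> 0"
      using assms by (simp add: mult_nonneg_nonpos)
    then show ?thesis using assms by linarith
  qed
  moreover have "range_policy \<kappa> D_st v_max (D\<^sub>0 x) \<le> \<kappa> * (D\<^sub>0 x - D_st)"
    by (simp add: range_policy_def)
  ultimately show ?thesis by (simp add: algebra_simps)
qed

text \<open>Saturation only lowers the speeds, so \<open>W\<close> may be dropped. The relative
  speeds of the vehicles in \<open>\<Phi>\<close> are replaced by \<open>v_bar\<close>, but the
  \<open>B\<^sub>1\<close> term stays exact, since it is later merged with another multiple of the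
  same relative speed.\<close>

lemma ccc_controller_le:
  assumes "\<kappa>_sf \<ge> \<kappa>" and "\<kappa> > 0" and "A \<ge> 0" and "B\<^sub>1 \<ge> 0" and "\<forall>k\<in>\<Phi>. B k \<ge> 0"
    and "motion_bounds v_bar a_min \<Phi> a\<^sub>1 v t x"
  shows "ccc_controller A B\<^sub>1 B \<Phi> (range_policy \<kappa> D_st v_max) (speed_policy v_max) v t x
    \<le> A * (max (h \<kappa>_sf D_sf x) 0 - \<kappa> * (D_st - D_sf)) + B\<^sub>1 * (v\<^sub>1 x - v\<^sub>0 x)
      + (\<Sum>k\<in>\<Phi>. B k) * v_bar"
  unfolding ccc_controller_def sum_distrib_right
proof (intro add_mono sum_mono mult_left_mono)
  show "range_policy \<kappa> D_st v_max (D\<^sub>0 x) - v\<^sub>0 x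
      \<le> max (h \<kappa>_sf D_sf x) 0 - \<kappa> * (D_st - D_sf)"
    using assms by (intro range_policy_minus_speed_le) (auto simp: motion_bounds_def)
next
  fix k assume "k \<in> \<Phi>"
  then have "\<bar>v k t - v\<^sub>0 x\<bar> \<le> v_bar"
    using assms by (auto simp: motion_bounds_def)
  then show "speed_policy v_max (v k t) - v\<^sub>0 x \<le> v_bar"
    by (simp add: speed_policy_def)
qed (use assms in \<open>auto simp: speed_policy_def\<close>)

text \<open>The right-hand side is \<open>\<xi>\<close> times the rate of \<open>h_e\<close> along
  the motion. The lower condition on \<open>A\<close> lets the offset
  \<open>\<kappa> * (D_st - D_sf)\<close> absorb the worst case of all speed and acceleration
  disturbances; the upper condition absorbs the part of the input that grows with
  \<open>h\<close>.\<close>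

lemma h_e_rate_ge:
  fixes \<xi> v_max \<kappa>_sf \<kappa> D_st D_sf A B\<^sub>1 \<gamma> :: real
  assumes "\<xi> > 0" and "\<kappa>_sf \<ge> \<kappa>" and "\<kappa> > 0" and "D_st > D_sf"
    and "A \<ge> 0" and "B\<^sub>1 \<ge> 0" and "\<forall>k\<in>\<Phi>. B k \<ge> 0"
    and bounds: "motion_bounds v_bar a_min \<Phi> a\<^sub>1 v t x"
    and upper: "A \<le> \<gamma> * (1 - \<xi> * \<kappa>_sf) - \<xi> * \<gamma>\<^sup>2"
    and lower: "A \<ge> ((\<bar>\<kappa>_sf - \<xi> * \<kappa>_sf\<^sup>2 - B\<^sub>1\<bar> + (\<Sum>k\<in>\<Phi>. B k)) * v_bar + \<xi> * \<kappa>_sf * a_min)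
              / (\<kappa> * (D_st - D_sf))"
  defines "u \<equiv> ccc_controller A B\<^sub>1 B \<Phi> (range_policy \<kappa> D_st v_max) (speed_policy v_max) v t x"
  shows "- (1 - \<xi> * \<kappa>_sf - \<xi> * \<gamma>) * h_e \<kappa>_sf D_sf \<gamma> x
      + (\<gamma> * (1 - \<xi> * \<kappa>_sf) - \<xi> * \<gamma>\<^sup>2) * min (h \<kappa>_sf D_sf x) 0
    \<le> \<xi> * (\<kappa>_sf * (a\<^sub>1 t - a\<^sub>0 x) + \<gamma> * (\<kappa>_sf * (v\<^sub>1 x - v\<^sub>0 x) - a\<^sub>0 x)) - (u - a\<^sub>0 x)"
proof -
  define G where "G = \<gamma> * (1 - \<xi> * \<kappa>_sf) - \<xi> * \<gamma>\<^sup>2"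
  define \<eta> where "\<eta> = h \<kappa>_sf D_sf x"
  define w where "w = v\<^sub>1 x - v\<^sub>0 x"
  \<comment> \<open>This is the coefficient of \<open>w\<close> that is left once the
    \<open>B\<^sub>1\<close> term of the controller has been subtracted.\<close>
  define c where "c = \<kappa>_sf - \<xi> * \<kappa>_sf\<^sup>2 - B\<^sub>1"
  define \<sigma> where "\<sigma> = (\<Sum>k\<in>\<Phi>. B k) * v_bar"
  have "u \<le> A * (max \<eta> 0 - \<kappa> * (D_st - D_sf)) + B\<^sub>1 * w + \<sigma>"
    unfolding u_def \<eta>_def w_def \<sigma>_def by (rule ccc_controller_le) (use assms in auto)
  moreover have "\<bar>c\<bar> * v_bar + \<sigma> + \<xi> * \<kappa>_sf * a_min \<le> A * (\<kappa> * (D_st - D_sf))"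
    using lower assms(3,4) by (simp add: pos_divide_le_eq c_def \<sigma>_def algebra_simps)
  moreover have "- (\<xi> * \<kappa>_sf * a_min) \<le> \<xi> * \<kappa>_sf * a\<^sub>1 t"
    using mult_left_mono[of "- a_min" "a\<^sub>1 t" "\<xi> * \<kappa>_sf"] bounds assms(1-3)
    by (simp add: motion_bounds_def)
  moreover have "- (\<bar>c\<bar> * v_bar) \<le> c * w"
  proof -
    have "\<bar>c * w\<bar> \<le> \<bar>c\<bar> * v_bar"
      unfolding abs_mult using bounds by (intro mult_left_mono) (auto simp: motion_bounds_def w_def)
    then show ?thesis by linarith
  qed
  moreover have "A * max \<eta> 0 \<le> G * max \<eta> 0"
    using upper by (intro mult_right_mono) (auto simp: G_def)
  \<comment> \<open>Replacing \<open>A\<close> by \<open>G\<close> on the positive part of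
    \<open>\<eta>\<close> leaves exactly \<open>G * min \<eta> 0\<close> when compared with
    \<open>G * \<eta>\<close>.\<close>
  moreover have "G * max \<eta> 0 + G * min \<eta> 0 = G * \<eta>"
    by (simp add: max_def min_def)
  \<comment> \<open>The acceleration is eliminated through \<open>a\<^sub>0 x = \<kappa>_sf * w +
    \<gamma> * \<eta> - h_e \<kappa>_sf D_sf \<gamma> x\<close>; collecting the coefficient of
    \<open>\<eta>\<close> gives \<open>G\<close>.\<close>
  moreover have "\<xi> * (\<kappa>_sf * (a\<^sub>1 t - a\<^sub>0 x) + \<gamma> * (\<kappa>_sf * w - a\<^sub>0 x)) + a\<^sub>0 x
      = \<xi> * \<kappa>_sf * a\<^sub>1 t + c * w + B\<^sub>1 * w + G * \<eta>
        - (1 - \<xi> * \<kappa>_sf - \<xi> * \<gamma>) * h_e \<kappa>_sf D_sf \<gamma> x"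
    unfolding c_def G_def \<eta>_def h_def h_e_def w_def
    by (simp add: algebra_simps power2_eq_square)
  ultimately show ?thesis
    unfolding w_def[symmetric] G_def[symmetric] \<eta>_def[symmetric]
    by (simp add: algebra_simps)
qed

theorem theorem3:
  fixes \<xi> v_max v_bar a_min \<gamma> \<kappa>_sf \<kappa> D_st D_sf A B\<^sub>1 :: real
    and \<Phi> :: "int set" and B :: "int \<Rightarrow> real"
    and a\<^sub>1 :: "real \<Rightarrow> real" and v :: "int \<Rightarrow> real \<Rightarrow> real"
  assumes "\<xi> > 0" and "v_max > 0" and "v_bar > 0" and "a_min > 0" and "\<gamma> > 0"
    and "\<kappa>_sf \<ge> \<kappa>" and "\<kappa> > 0" and "D_st > D_sf"
    and "finite \<Phi>" and "\<forall>k\<in>\<Phi>. k > 1"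
    and "A \<ge> 0" and "B\<^sub>1 \<ge> 0" and "\<forall>k\<in>\<Phi>. B k \<ge> 0"
    and "continuous_on UNIV a\<^sub>1" and "\<forall>k\<in>\<Phi>. continuous_on UNIV (v k)"
    and "A \<le> (1 - \<xi> * \<kappa>_sf)\<^sup>2 / (4 * \<xi>) - \<xi> * (\<gamma> - (1 - \<xi> * \<kappa>_sf) / (2 * \<xi>))\<^sup>2"
    and "A \<ge> ((\<bar>\<kappa>_sf - \<xi> * \<kappa>_sf\<^sup>2 - B\<^sub>1\<bar> + (\<Sum>k\<in>\<Phi>. B k)) * v_bar + \<xi> * \<kappa>_sf * a_min)
              / (\<kappa> * (D_st - D_sf))"
  shows "safe_wrt
    (lag_dynamics \<xi> a\<^sub>1
      (ccc_controller A B\<^sub>1 B \<Phi> (range_policy \<kappa> D_st v_max) (speed_policy v_max) v))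
    (motion_bounds v_bar a_min \<Phi> a\<^sub>1 v)
    (S \<kappa>_sf D_sf \<inter> S_e \<kappa>_sf D_sf \<gamma>)"
proof -
  let ?u = "ccc_controller A B\<^sub>1 B \<Phi> (range_policy \<kappa> D_st v_max) (speed_policy v_max) v"
  let ?G = "\<gamma> * (1 - \<xi> * \<kappa>_sf) - \<xi> * \<gamma>\<^sup>2"
  have "(1 - \<xi> * \<kappa>_sf)\<^sup>2 / (4 * \<xi>) - \<xi> * (\<gamma> - (1 - \<xi> * \<kappa>_sf) / (2 * \<xi>))\<^sup>2 = ?G"
  proof -
    \<comment> \<open>As a function of \<gamma>, \<open>?G\<close> is a concave parabola with vertex
      at \<open>z\<close> and maximum \<open>\<xi> * z\<^sup>2\<close>, so the first condition on
      \<open>A\<close> is \<open>?G\<close> with the square completed.\<close>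
    define z where "z = (1 - \<xi> * \<kappa>_sf) / (2 * \<xi>)"
    then have z: "1 - \<xi> * \<kappa>_sf = 2 * \<xi> * z"
      using assms(1) by simp
    have "(2 * \<xi> * z)\<^sup>2 / (4 * \<xi>) - \<xi> * (\<gamma> - z)\<^sup>2 = \<gamma> * (2 * \<xi> * z) - \<xi> * \<gamma>\<^sup>2"
      using assms(1) by (simp add: power2_eq_square algebra_simps)
    then show ?thesis
      unfolding z_def[symmetric] unfolding z .
  qed
  with assms(16) have upper: "A \<le> ?G" by (rule ord_le_eq_trans)
  show ?thesis
    unfolding safe_wrt_def
  proof (intro allI impI ballI)
    fix J x t\<^sub>0 t
    assume sol: "solution_on J (lag_dynamics \<xi> a\<^sub>1 ?u) x"
      and bounds: "\<forall>t\<in>J. motion_bounds v_bar a_min \<Phi> a\<^sub>1 v t (x t)"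
      and "t\<^sub>0 \<in> J" and init: "x t\<^sub>0 \<in> S \<kappa>_sf D_sf \<inter> S_e \<kappa>_sf D_sf \<gamma>"
      and "t \<in> J" and "t\<^sub>0 \<le> t"
    have "is_interval J"
      and x': "\<forall>s\<in>J. (x has_vector_derivative lag_dynamics \<xi> a\<^sub>1 ?u s (x s)) (at s within J)"
      using sol unfolding solution_on_def by blast+
    \<comment> \<open>The motion may live on any interval \<open>J\<close>; the argument only uses
      its restriction to the compact interval between the two times.\<close>
    then have sub: "{t\<^sub>0..t} \<subseteq> J"
      using \<open>t\<^sub>0 \<in> J\<close> \<open>t \<in> J\<close> unfolding is_interval_1 by (meson atLeastAtMost_iff subsetI)
    have comp: "((\<lambda>s. x s $ i) has_real_derivative lag_dynamics \<xi> a\<^sub>1 ?u s (x s) $ i)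
        (at s within {t\<^sub>0..t})" if "s \<in> {t\<^sub>0..t}" for s i
    proof -
      have "(x has_vector_derivative lag_dynamics \<xi> a\<^sub>1 ?u s (x s)) (at s within {t\<^sub>0..t})"
        using x' sub that by (blast intro: has_vector_derivative_within_subset)
      then show ?thesis
        unfolding has_real_derivative_iff_has_vector_derivative
        by (rule bounded_linear.has_vector_derivative[OF bounded_linear_vec_nth])
    qed
    let ?h' = "\<lambda>s. \<kappa>_sf * (v\<^sub>1 (x s) - v\<^sub>0 (x s)) - a\<^sub>0 (x s)"
    let ?e' = "\<lambda>s. \<kappa>_sf * (a\<^sub>1 s - a\<^sub>0 (x s)) - (?u s (x s) - a\<^sub>0 (x s)) / \<xi> + \<gamma> * ?h' s"
    have comps: "((\<lambda>s. D\<^sub>0 (x s)) has_real_derivative v\<^sub>1 (x s) - v\<^sub>0 (x s)) (at s within {t\<^sub>0..t})"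
      "((\<lambda>s. v\<^sub>0 (x s)) has_real_derivative a\<^sub>0 (x s)) (at s within {t\<^sub>0..t})"
      "((\<lambda>s. a\<^sub>0 (x s)) has_real_derivative (?u s (x s) - a\<^sub>0 (x s)) / \<xi>) (at s within {t\<^sub>0..t})"
      "((\<lambda>s. v\<^sub>1 (x s)) has_real_derivative a\<^sub>1 s) (at s within {t\<^sub>0..t})"
      if "s \<in> {t\<^sub>0..t}" for s
      using comp[OF that, of 1] comp[OF that, of 2] comp[OF that, of 3] comp[OF that, of 4]
      by (simp_all add: lag_dynamics_def)
    have h': "((\<lambda>s. h \<kappa>_sf D_sf (x s)) has_real_derivative ?h' s) (at s within {t\<^sub>0..t})"
      if "s \<in> {t\<^sub>0..t}" for s
      unfolding h_def
      using DERIV_diff[OF DERIV_cmult[OF DERIV_diff[OF comps(1)[OF that] DERIV_const]] comps(2)[OF that]]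
      by simp
    have e': "((\<lambda>s. h_e \<kappa>_sf D_sf \<gamma> (x s)) has_real_derivative ?e' s) (at s within {t\<^sub>0..t})"
      if "s \<in> {t\<^sub>0..t}" for s
      \<comment> \<open>Folding the last summand back into \<open>\<gamma>\<close> times
        \<open>h\<close> allows the derivative \<open>h'\<close> to be reused.\<close>
      unfolding h_e_def h_def[symmetric]
      by (intro DERIV_add DERIV_diff DERIV_cmult comps h' that)
    have "h \<kappa>_sf D_sf (x t) \<ge> 0 \<and> h_e \<kappa>_sf D_sf \<gamma> (x t) \<ge> 0"
    \<comment> \<open>The first pair of coefficients comes from the identity
      \<open>?h' s = h_e - \<gamma> * h\<close>, weakened by replacing \<open>h_e\<close> with its
      negative part; the second is the estimate \<open>h_e_rate_ge\<close> divided by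
      \<open>\<xi>\<close>. In the instantiation, \<open>\<gamma>\<close> to the left of the
      equality is the lemma's own coefficient, not the gain. Nonnegativity of \<delta> follows from
      \<open>?G\<close> \<ge> \<open>A\<close> \<ge> 0.\<close>
    proof (rule cooperative_nonneg[OF \<open>t\<^sub>0 \<le> t\<close> _ _ h' e',
          where \<alpha> = "- \<gamma>" and \<beta> = 1 and \<gamma> = "- (1 - \<xi> * \<kappa>_sf - \<xi> * \<gamma>) / \<xi>" and \<delta> = "?G / \<xi>"])
      fix s assume s: "s \<in> {t\<^sub>0..t}"
      show "- \<gamma> * h \<kappa>_sf D_sf (x s) + 1 * min (h_e \<kappa>_sf D_sf \<gamma> (x s)) 0 \<le> ?h' s"
        by (simp add: h_def h_e_def min_def)
      have "- (1 - \<xi> * \<kappa>_sf - \<xi> * \<gamma>) * h_e \<kappa>_sf D_sf \<gamma> (x s) + ?G * min (h \<kappa>_sf D_sf (x s)) 0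
          \<le> \<xi> * (\<kappa>_sf * (a\<^sub>1 s - a\<^sub>0 (x s)) + \<gamma> * ?h' s) - (?u s (x s) - a\<^sub>0 (x s))"
        by (rule h_e_rate_ge[OF assms(1,6-8,11-13) _ upper assms(17)])
          (use bounds sub s in auto)
      also have "\<dots> = \<xi> * ?e' s"
        using assms(1) by (simp add: distrib_left right_diff_distrib diff_divide_distrib)
      finally have "(- (1 - \<xi> * \<kappa>_sf - \<xi> * \<gamma>) * h_e \<kappa>_sf D_sf \<gamma> (x s)
          + ?G * min (h \<kappa>_sf D_sf (x s)) 0) / \<xi> \<le> ?e' s"
        by (subst pos_divide_le_eq[OF assms(1)], subst mult.commute[of _ \<xi>])
      then show "- (1 - \<xi> * \<kappa>_sf - \<xi> * \<gamma>) / \<xi> * h_e \<kappa>_sf D_sf \<gamma> (x s)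
          + ?G / \<xi> * min (h \<kappa>_sf D_sf (x s)) 0 \<le> ?e' s"
        by (simp only: add_divide_distrib times_divide_eq_left)
    qed (use assms(1,11) upper init in \<open>auto simp: S_def S_e_def\<close>)
    then show "x t \<in> S \<kappa>_sf D_sf \<inter> S_e \<kappa>_sf D_sf \<gamma>"
      by (simp add: S_def S_e_def)
  qed
qed

end
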